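(* Let $0<u<v$, $s\in(0,1]$ and $q\ge 1$. Then $$\left|(s-1)L_s^s(u,v)+A^s(u,v)\right|\le \left(\frac{s^qA^{q-1}(u,v)}{(s+1)(s+2)2^q}\right)^{\frac1q}\Big(((s+1)u+v)A^{(s-1)q}(u,v)+((s+1)v+u)v^{(s-1)q}\Big)^{\frac1q}$$ $$+\left(\frac{s^qA^{q-1}(u,v)}{(s+1)(s+2)2^q}\right)^{\frac1q}\Big(((s+1)v+u)A^{(s-1)q}(u,v)+((s+1)u+v)u^{(s-1)q}\Big)^{\frac1q}.$$
   Context: $A(u,v)=\frac{u+v}{2}$ is the arithmetic mean, and for $u,v>0$, $u\ne v$, $p\in\mathbb{R}\setminus\{-1,0\}$, $L_p(u,v)=\left(\frac{v^{p+1}-u^{p+1}}{(p+1)(v-u)}\right)^{1/p}$ is the generalized logarithmic mean. Notation: $A^r(u,v)=(A(u,v))^r$ and $L_s^s(u,v)=(L_s(u,v))^s=\frac{v^{s+1}-u^{s+1}}{(s+1)(v-u)}$. *)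

theory Defs
  imports Complex_Main
begin

definition arith_mean :: "real \<Rightarrow> real \<Rightarrow> real" where
  "arith_mean u v = (u + v) / 2"

(* Meaningful only for u, v > 0, u \<noteq> v and p \<notin> {-1, 0}; elsewhere the value is an
   artefact of totality. *)
definition gen_log_mean :: "real \<Rightarrow> real \<Rightarrow> real \<Rightarrow> real" where
  "gen_log_mean p u v =
     ((v powr (p + 1) - u powr (p + 1)) / ((p + 1) * (v - u))) powr (1 / p)"

end

theory Submission imports Defs "HOL-Analysis.Analysis" begin

text \<open>
  Write \<open>a = (u + v) / 2\<close> and \<open>f x = x powr s\<close>. The left-hand side is a weighted integral of \<open>f'\<close>. On each half of \<open>[u, v]\<close>, parametrised affinely by \<open>t \<in> [0, 1]\<close>,
  integration by parts evaluates the integral of \<open>(u + (v - u) * t) * f'\<close>; the boundary terms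
  of the two halves combine, and half the sum of the two integrals is exactly
  \<open>(s - 1) * L powr s + a powr s\<close>, where \<open>L\<close> is the logarithmic mean
  (\<open>integral_affine_weight_deriv\<close>).

  Weight and \<open>f'\<close> are positive, so it remains to bound each integral from above. Hoelder's
  inequality, in its weighted power mean form, replaces \<open>f'\<close> by \<open>f' powr q\<close> at the cost of a
  factor made of the total weight \<open>a\<close> (\<open>weighted_power_mean_integral_le\<close>). The function
  \<open>f' powr q\<close>, that is, \<open>s powr q * x powr ((s - 1) * q)\<close>, has a nonpositive exponent and hence is
  convex; so it lies below its chord on each half, and the weighted integral of the chord is a
  combination of the endpoint values with coefficients \<open>(2 * u + v) / 6\<close> and
  \<open>(u + 2 * v) / 6\<close>. These are the coefficients of the claim for \<open>s = 1\<close>, and the coefficients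
  \<open>((s + 1) * u + v) / ((s + 1) * (s + 2))\<close> of the claim only increase as \<open>s\<close> decreases.
\<close>

section \<open>The weighted power mean inequality\<close>

text \<open>
  The powers of \<open>l\<close> cancel when the geometric mean of \<open>x powr q * l powr (1 - q)\<close> and \<open>l\<close> with
  weights \<open>1 / q\<close> and \<open>1 - 1 / q\<close> is formed; it is \<open>x\<close>. Equality holds at \<open>l = x\<close>: the right-hand
  side is the tangent at \<open>l powr q\<close> of the concave function \<open>y powr (1 / q)\<close>, taken at
  \<open>y = x powr q\<close>.
\<close>

lemma powr_tangent_bound:
  fixes x l q :: real
  assumes "0 < x" "0 < l" "1 \<le> q"
  shows "x \<le> 1 / q * l powr (1 - q) * x powr q + (1 - 1 / q) * l"
proof -
  have "(x powr q * l powr (1 - q)) powr (1 / q) * l powr (1 - 1 / q)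
      = x * (l powr ((1 - q) / q) * l powr (1 - 1 / q))"
    using assms by (simp add: powr_mult powr_powr)
  also have "l powr ((1 - q) / q) * l powr (1 - 1 / q) = 1"
    using assms by (simp add: powr_add [symmetric] diff_divide_distrib)
  finally show ?thesis
    using Youngs_inequality_0 [of "1 / q" "1 - 1 / q" "x powr q * l powr (1 - q)" l] assms
    by (simp add: mult_ac)
qed

text \<open>
  Hoelder's inequality for the measure with density \<open>w\<close>, with a majorant \<open>b\<close> of \<open>g powr q\<close> in
  place of \<open>g powr q\<close> itself. Integrating the tangent bound gives an inequality that is linear in
  the integrals \<open>W\<close> and \<open>B\<close> for every \<open>l > 0\<close>, and the choice \<open>l = (B / W) powr (1 / q)\<close>
  optimises it.
\<close>

lemma weighted_power_mean_integral_le: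
  fixes w g b :: "'a::euclidean_space \<Rightarrow> real"
  assumes "1 \<le> q" "0 < W" "0 < B"
    and w: "\<And>x. x \<in> S \<Longrightarrow> 0 \<le> w x"
    and g: "\<And>x. x \<in> S \<Longrightarrow> 0 < g x"
    and b: "\<And>x. x \<in> S \<Longrightarrow> g x powr q \<le> b x"
    and intW: "(w has_integral W) S"
    and intB: "((\<lambda>x. w x * b x) has_integral B) S"
    and intI: "((\<lambda>x. w x * g x) has_integral I) S"
  shows "I \<le> (W powr (q - 1) * B) powr (1 / q)"
proof -
  define l where "l = (B / W) powr (1 / q)"
  have l: "0 < l" and lq: "l powr q = B / W"
    using assms(1-3) by (simp_all add: l_def powr_powr)
  have "I \<le> 1 / q * l powr (1 - q) * B + (1 - 1 / q) * l * W"
  proof (rule has_integral_le [OF intI])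
    show "((\<lambda>x. 1 / q * l powr (1 - q) * (w x * b x) + (1 - 1 / q) * l * w x) has_integral
        1 / q * l powr (1 - q) * B + (1 - 1 / q) * l * W) S"
      by (intro has_integral_add has_integral_mult_right intB intW)
  next
    fix x assume x: "x \<in> S"
    have "g x \<le> 1 / q * l powr (1 - q) * g x powr q + (1 - 1 / q) * l"
      using powr_tangent_bound g x l assms(1) by blast
    also have "\<dots> \<le> 1 / q * l powr (1 - q) * b x + (1 - 1 / q) * l"
      using assms(1) b [OF x] by (intro add_right_mono mult_left_mono) auto
    finally have "w x * g x \<le> w x * (1 / q * l powr (1 - q) * b x + (1 - 1 / q) * l)"
      using w [OF x] by (rule mult_left_mono)
    then show "w x * g x \<le> 1 / q * l powr (1 - q) * (w x * b x) + (1 - 1 / q) * l * w x"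
      by (simp add: algebra_simps)
  qed
  also have "l powr (1 - q) * B = l * W"
    using assms(1-3) l lq by (simp add: powr_diff)
  then have "1 / q * l powr (1 - q) * B + (1 - 1 / q) * l * W = l * W"
    by (simp add: algebra_simps)
  also have "l * W = (W powr (q - 1) * B) powr (1 / q)"
  proof -
    have "W powr (q - 1) * B = (l * W) powr q"
      using assms(1-3) l lq by (simp add: powr_mult powr_diff)
    then show ?thesis
      using assms(1,2) l by (simp add: powr_powr)
  qed
  finally show ?thesis .
qed

section \<open>Integrals against an affine weight\<close>

text \<open>
  Against the weight \<open>u + (v - u) * t\<close>, of total mass \<open>(u + v) / 2\<close>, the chord from \<open>P\<close> to \<open>Q\<close>
  integrates to \<open>(2 * u + v) / 6 * P + (u + 2 * v) / 6 * Q\<close>.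
\<close>

lemma affine_weight_integral_le:
  fixes u v q P Q I :: real and g :: "real \<Rightarrow> real"
  assumes "0 < u" "0 < v" "1 \<le> q" "0 < P" "0 < Q"
    and g: "\<And>t. t \<in> {0..1} \<Longrightarrow> 0 < g t"
    and chord: "\<And>t. t \<in> {0..1} \<Longrightarrow> g t powr q \<le> (1 - t) * P + t * Q"
    and intI: "((\<lambda>t. (u + (v - u) * t) * g t) has_integral I) {0..1}"
  shows "I \<le> (((u + v) / 2) powr (q - 1) * ((2 * u + v) / 6 * P + (u + 2 * v) / 6 * Q))
    powr (1 / q)"
proof (rule weighted_power_mean_integral_le [OF assms(3) _ _ _ g chord _ _ intI])
  show "0 < (u + v) / 2" "0 < (2 * u + v) / 6 * P + (u + 2 * v) / 6 * Q"
    using assms(1,2,4,5) by (auto intro!: add_pos_pos mult_pos_pos)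
  show "0 \<le> u + (v - u) * t" if "t \<in> {0..1}" for t
  proof -
    have "0 \<le> (1 - t) * u + t * v"
      using that assms(1,2) by simp
    then show ?thesis
      by (simp add: algebra_simps)
  qed
  let ?W = "\<lambda>t. u * t + (v - u) * t ^ 2 / 2"
  have "((\<lambda>t. u + (v - u) * t) has_integral ?W 1 - ?W 0) {0..1}"
    by (intro fundamental_theorem_of_calculus)
      (auto simp flip: has_real_derivative_iff_has_vector_derivative intro!: derivative_eq_intros)
  then show "((\<lambda>t. u + (v - u) * t) has_integral (u + v) / 2) {0..1}"
    by (simp add: field_simps)
  let ?B = "\<lambda>t. u * P * t + (u * (Q - P) + (v - u) * P) * t ^ 2 / 2 + (v - u) * (Q - P) * t ^ 3 / 3"
  have "((\<lambda>t. (u + (v - u) * t) * ((1 - t) * P + t * Q)) has_integral ?B 1 - ?B 0) {0..1}"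
    by (intro fundamental_theorem_of_calculus)
      (auto simp flip: has_real_derivative_iff_has_vector_derivative
        intro!: derivative_eq_intros simp: field_simps power2_eq_square)
  moreover have "?B 1 - ?B 0 = (2 * u + v) / 6 * P + (u + 2 * v) / 6 * Q"
    by (simp add: field_simps)
  ultimately show "((\<lambda>t. (u + (v - u) * t) * ((1 - t) * P + t * Q)) has_integral
      (2 * u + v) / 6 * P + (u + 2 * v) / 6 * Q) {0..1}"
    by simp
qed

text \<open>
  Integration by parts. The weight has slope \<open>2 * h\<close> and \<open>c + h * t\<close> has slope \<open>h\<close>, so the last term
  is twice the mean value of \<open>f\<close> on \<open>[c, c + h]\<close>.
\<close>

lemma integral_affine_weight_deriv:
  fixes u v c h :: real and f f' F :: "real \<Rightarrow> real"
  assumes h: "0 < h" "v - u = 2 * h"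
    and F: "\<And>x. x \<in> {c..c + h} \<Longrightarrow> (F has_real_derivative f x) (at x)"
    and f: "\<And>x. x \<in> {c..c + h} \<Longrightarrow> (f has_real_derivative f' x) (at x)"
  shows "((\<lambda>t. (u + (v - u) * t) * f' (c + h * t)) has_integral
    (v * f (c + h) - u * f c) / h - 2 * (F (c + h) - F c) / h) {0..1}"
proof -
  let ?\<Phi> = "\<lambda>t. (u + (v - u) * t) * f (c + h * t) / h - 2 * F (c + h * t) / h"
  have "((\<lambda>t. (u + (v - u) * t) * f' (c + h * t)) has_integral ?\<Phi> 1 - ?\<Phi> 0) {0..1}"
  proof (rule fundamental_theorem_of_calculus)
    fix t :: real assume "t \<in> {0..1}"
    then have mem: "c + h * t \<in> {c..c + h}"
      using h(1) by (simp add: mult_left_le)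
    have shift: "((\<lambda>t. c + h * t) has_real_derivative h) (at t)"
      by (auto intro!: derivative_eq_intros)
    have weight: "((\<lambda>t. u + (v - u) * t) has_real_derivative v - u) (at t)"
      by (auto intro!: derivative_eq_intros)
    note D = DERIV_diff [OF
        DERIV_cdivide [OF DERIV_mult [OF weight DERIV_chain2 [OF f [OF mem] shift]]]
        DERIV_cdivide [OF DERIV_cmult [OF DERIV_chain2 [OF F [OF mem] shift]]]]
    have "(?\<Phi> has_real_derivative (u + (v - u) * t) * f' (c + h * t)) (at t)"
      by (rule DERIV_cong [OF D]) (use h in \<open>simp add: field_simps\<close>)
    then show "(?\<Phi> has_vector_derivative (u + (v - u) * t) * f' (c + h * t)) (at t within {0..1})"
      by (simp add: has_real_derivative_iff_has_vector_derivative
          has_vector_derivative_at_within)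
  qed simp
  then show ?thesis
    by (simp add: diff_divide_distrib algebra_simps)
qed

section \<open>Power functions\<close>

lemma convex_on_powr_nonpos:
  fixes r :: real
  assumes "r \<le> 0"
  shows "convex_on {0<..} (\<lambda>x. x powr r)"
proof (rule f''_ge0_imp_convex)
  fix x :: real assume x: "x \<in> {0<..}"
  then show "((\<lambda>x. x powr r) has_real_derivative r * x powr (r - 1)) (at x)"
    by (auto intro!: derivative_eq_intros)
  show "((\<lambda>x. r * x powr (r - 1)) has_real_derivative r * ((r - 1) * x powr (r - 2))) (at x)"
    using x by (auto intro!: derivative_eq_intros)
  have "0 \<le> r * (r - 1)"
    using assms by (intro mult_nonpos_nonpos) auto
  then show "0 \<le> r * ((r - 1) * x powr (r - 2))"
    by (simp flip: mult.assoc)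
qed simp

text \<open>
  The bound for one of the two halves. Its coefficients come from those of
  \<open>affine_weight_integral_le\<close> through \<open>(s + 1) * (s + 2) \<le> 6\<close> and \<open>s + 2 \<le> 3\<close>.
\<close>

lemma half_interval_bound:
  fixes u v s q c h I :: real
  assumes "0 < u" "0 < v" "0 < s" "s \<le> 1" "1 \<le> q" "0 < c" "0 < h"
    and intI: "((\<lambda>t. (u + (v - u) * t) * (s * (c + h * t) powr (s - 1))) has_integral I) {0..1}"
  shows "I / 2 \<le> (s powr q * ((u + v) / 2) powr (q - 1) / ((s + 1) * (s + 2) * 2 powr q))
      powr (1 / q)
    * (((s + 1) * u + v) * c powr ((s - 1) * q)
       + ((s + 1) * v + u) * (c + h) powr ((s - 1) * q)) powr (1 / q)"
proof -
  let ?A = "(u + v) / 2" and ?p = "(s - 1) * q"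
  let ?P = "c powr ?p" and ?Q = "(c + h) powr ?p"
  let ?X = "((s + 1) * u + v) * ?P + ((s + 1) * v + u) * ?Q"
  let ?d = "(s + 1) * (s + 2)"
  have d: "0 < ?d"
    using assms(3) by simp
  have I: "I \<le> (?A powr (q - 1) * ((2 * u + v) / 6 * (s powr q * ?P)
      + (u + 2 * v) / 6 * (s powr q * ?Q))) powr (1 / q)"
  proof (rule affine_weight_integral_le [OF assms(1,2,5) _ _ _ _ intI])
    fix t :: real assume t: "t \<in> {0..1}"
    have pos: "0 < c + h * t"
      using t assms(6,7) by (simp add: add_pos_nonneg)
    then show "0 < s * (c + h * t) powr (s - 1)"
      using assms(3) by simp
    have "convex_on {0<..} (\<lambda>x. x powr ?p)"
      using assms(4,5) by (intro convex_on_powr_nonpos mult_nonpos_nonneg) auto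
    from convex_onD [OF this, of t c "c + h"]
    have "(c + h * t) powr ?p \<le> (1 - t) * ?P + t * ?Q"
      using t assms(6,7) by (simp add: algebra_simps)
    then have "s powr q * (c + h * t) powr ?p \<le> s powr q * ((1 - t) * ?P + t * ?Q)"
      by (intro mult_left_mono) auto
    then show "(s * (c + h * t) powr (s - 1)) powr q
        \<le> (1 - t) * (s powr q * ?P) + t * (s powr q * ?Q)"
      using assms(3) pos by (simp add: powr_mult powr_powr algebra_simps)
  qed (use assms in auto)
  have coeff: "(2 * x + y) / 6 \<le> ((s + 1) * x + y) / ?d" if "0 < x" "0 < y" for x y :: real
  proof -
    have "?d \<le> 2 * 3"
      using assms(3,4) by (intro mult_mono) auto
    then have "?d * y \<le> 6 * y"
      using that by simp
    moreover have "2 * (s + 1) * x * (s + 2) \<le> 2 * (s + 1) * x * 3"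
      using assms(3,4) that by (intro mult_left_mono) auto
    ultimately have "(2 * x + y) * ?d \<le> ((s + 1) * x + y) * 6"
      by (simp add: algebra_simps)
    then show ?thesis
      using d by (simp add: divide_simps)
  qed
  have "(2 * u + v) / 6 * (s powr q * ?P) + (u + 2 * v) / 6 * (s powr q * ?Q)
      \<le> ((s + 1) * u + v) / ?d * (s powr q * ?P) + ((s + 1) * v + u) / ?d * (s powr q * ?Q)"
    using coeff [of u v] coeff [of v u] assms(1,2)
    by (intro add_mono mult_right_mono) (auto simp: add.commute)
  also have "\<dots> = s powr q / ?d * ?X"
    by (simp add: add_divide_distrib distrib_left distrib_right mult_ac)
  finally have "?A powr (q - 1) * ((2 * u + v) / 6 * (s powr q * ?P)
      + (u + 2 * v) / 6 * (s powr q * ?Q)) \<le> ?A powr (q - 1) * (s powr q / ?d * ?X)"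
    by (intro mult_left_mono) auto
  then have "I \<le> (?A powr (q - 1) * (s powr q / ?d * ?X)) powr (1 / q)"
    by (intro order_trans [OF I powr_mono2]) (use assms in auto)
  also have "?A powr (q - 1) * (s powr q / ?d * ?X)
      = 2 powr q * (s powr q * ?A powr (q - 1) / (?d * 2 powr q)) * ?X"
    by simp
  also have "\<dots> powr (1 / q)
      = 2 * ((s powr q * ?A powr (q - 1) / (?d * 2 powr q)) powr (1 / q) * ?X powr (1 / q))"
    using assms d by (simp only: powr_mult) (simp add: powr_powr)
  finally show ?thesis
    by simp
qed

section \<open>The inequality for the arithmetic and logarithmic means\<close>

theorem proposition3:
  fixes u v s q :: real
  assumes "0 < u" and "u < v" and "0 < s" and "s \<le> 1" and "1 \<le> q"
  shows "\<bar>(s - 1) * (gen_log_mean s u v) powr s + (arith_mean u v) powr s\<bar>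
    \<le> (s powr q * (arith_mean u v) powr (q - 1) / ((s + 1) * (s + 2) * 2 powr q)) powr (1 / q)
        * (((s + 1) * u + v) * (arith_mean u v) powr ((s - 1) * q)
           + ((s + 1) * v + u) * v powr ((s - 1) * q)) powr (1 / q)
      + (s powr q * (arith_mean u v) powr (q - 1) / ((s + 1) * (s + 2) * 2 powr q)) powr (1 / q)
        * (((s + 1) * v + u) * (arith_mean u v) powr ((s - 1) * q)
           + ((s + 1) * u + v) * u powr ((s - 1) * q)) powr (1 / q)"
proof -
  define a where "a = (u + v) / 2"
  define h where "h = (v - u) / 2"
  define F where "F x = x powr (s + 1) / (s + 1)" for x :: real
  let ?w = "\<lambda>t. u + (v - u) * t" and ?f' = "\<lambda>x. s * x powr (s - 1)"
  define I where "I c = (v * (c + h) powr s - u * c powr s) / h - 2 * (F (c + h) - F c) / h" for c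
  have a: "0 < a" "arith_mean u v = a" and h: "0 < h" "v - u = 2 * h"
    and ends: "u + h = a" "a + h = v"
    using assms by (auto simp: a_def h_def arith_mean_def field_simps)
  have int: "((\<lambda>t. ?w t * ?f' (c + h * t)) has_integral I c) {0..1}" if "0 < c" for c
    unfolding I_def using that assms(3)
    by (intro integral_affine_weight_deriv [OF h, where f = "\<lambda>x. x powr s" and F = F])
      (auto simp: F_def [abs_def] intro!: derivative_eq_intros)
  have nonneg: "0 \<le> I c" if "0 < c" for c
    using assms h
    by (intro has_integral_nonneg [OF int [OF that]]) auto
  have L: "gen_log_mean s u v powr s = (F v - F u) / (v - u)"
  proof -
    have "0 \<le> (v powr (s + 1) - u powr (s + 1)) / ((s + 1) * (v - u))"
      using assms by (intro divide_nonneg_nonneg) (simp_all add: powr_mono2)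
    then have "gen_log_mean s u v powr s
        = (v powr (s + 1) - u powr (s + 1)) / ((s + 1) * (v - u))"
      using assms(3) by (simp add: gen_log_mean_def powr_powr del: abs_divide)
    then show ?thesis
      by (simp add: F_def diff_divide_distrib)
  qed
  have "v * v powr s = (s + 1) * F v" "u * u powr s = (s + 1) * F u"
    using assms by (simp_all add: F_def powr_add)
  then have "I a + I u = ((s + 1) * F v - (s + 1) * F u + (v - u) * a powr s) / h
      - 2 * (F v - F u) / h"
    unfolding I_def ends by (simp add: diff_divide_distrib add_divide_distrib algebra_simps)
  also have "\<dots> = 2 * ((s - 1) * gen_log_mean s u v powr s + a powr s)"
    unfolding L using h by (simp add: field_simps)
  finally have rep: "(s - 1) * gen_log_mean s u v powr s + a powr s = I a / 2 + I u / 2"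
    by simp
  have "0 < v"
    using assms by simp
  note bound = half_interval_bound [OF assms(1) \<open>0 < v\<close> assms(3-5) _ h(1) int, folded a_def]
  show ?thesis
    using bound [OF a(1) a(1)] bound [OF assms(1,1)] nonneg [OF a(1)] nonneg [OF assms(1)]
    unfolding a(2) rep ends by (simp add: add.commute)
qed

end
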